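(* Let $\Omega\subset\mathbb{H}$ be a slice-open set. Every slice regular function $f:\Omega\to\mathbb{H}$ is path-slice.
   Context: $\mathbb{H}$ denotes the quaternions and $\mathbb{S}=\{q\in\mathbb{H}: q^2=-1\}$. For $I\in\mathbb{S}$, $\mathbb{C}_I=\mathbb{R}+I\mathbb{R}$, and $\Omega_I:=\Omega\cap\mathbb{C}_I$. A set $\Omega\subset\mathbb{H}$ is slice-open if $\Omega_I$ is open in $\mathbb{C}_I$ for every $I\in\mathbb{S}$. For $U$ open in $\mathbb{C}_I$, $h:U\to\mathbb{H}$ is left $\mathbb{C}_I$-holomorphic if it has continuous partial derivatives and $\frac12\left(\frac{\partial}{\partial x}+I\frac{\partial}{\partial y}\right)h(x+yI)=0$ on $U$. A function $f:\Omega\to\mathbb{H}$ on a slice-open set is slice regular if $f|_{\Omega_I}$ is left $\mathbb{C}_I$-holomorphic for every $I\in\mathbb{S}$. $\mathscr{P}(\mathbb{C})$ is the set of paths (continuous maps) $\gamma:[0,1]\to\mathbb{C}$ with $\gamma(0)\in\mathbb{R}$. For $I\in\mathbb{S}$, $\mathcal{P}_I:\mathbb{C}\to\mathbb{C}_I$, $x+yi\mapsto x+yI$, and $\gamma^I:=\mathcal{P}_I\circ\gamma$; $\gamma^I\subset\Omega$ means that the image of $\gamma^I$ lies in $\Omega$. A function $f:\Omega\to\mathbb{H}$ with $\Omega\subset\mathbb{H}$ is path-slice if for every $\gamma\in\mathscr{P}(\mathbb{C})$ there is a function $F_\gamma:[0,1]\to\mathbb{H}^{2\times1}$ such that $f\circ\gamma^I=(1,I)F_\gamma$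 for every $I\in\mathbb{S}$ with $\gamma^I\subset\Omega$. *)

theory Defs
  imports "HOL-Analysis.Analysis"
begin

section \<open>The quaternions\<close>

codatatype quat = Quat (qRe: real) (qIm1: real) (qIm2: real) (qIm3: real)

lemma quat_eqI [intro?]:
  "qRe x = qRe y \<Longrightarrow> qIm1 x = qIm1 y \<Longrightarrow> qIm2 x = qIm2 y \<Longrightarrow> qIm3 x = qIm3 y \<Longrightarrow> x = y"
  by (rule quat.expand) simp

lemma quat_eq_iff:
  "x = y \<longleftrightarrow> qRe x = qRe y \<and> qIm1 x = qIm1 y \<and> qIm2 x = qIm2 y \<and> qIm3 x = qIm3 y"
  by (auto intro: quat.expand)

instantiation quat :: ab_group_add
begin

primcorec zero_quat where
  "qRe 0 = 0" | "qIm1 0 = 0" | "qIm2 0 = 0" | "qIm3 0 = 0"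

primcorec plus_quat where
  "qRe (x + y) = qRe x + qRe y"
| "qIm1 (x + y) = qIm1 x + qIm1 y"
| "qIm2 (x + y) = qIm2 x + qIm2 y"
| "qIm3 (x + y) = qIm3 x + qIm3 y"

primcorec uminus_quat where
  "qRe (- x) = - qRe x"
| "qIm1 (- x) = - qIm1 x"
| "qIm2 (- x) = - qIm2 x"
| "qIm3 (- x) = - qIm3 x"

primcorec minus_quat where
  "qRe (x - y) = qRe x - qRe y"
| "qIm1 (x - y) = qIm1 x - qIm1 y"
| "qIm2 (x - y) = qIm2 x - qIm2 y"
| "qIm3 (x - y) = qIm3 x - qIm3 y"

instance
  by standard (simp_all add: quat_eq_iff)

end

text \<open>Hamilton's product, with \<open>i j = k\<close>, \<open>j k = i\<close>, \<open>k i = j\<close>.\<close>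

instantiation quat :: ring_1
begin

primcorec one_quat where
  "qRe 1 = 1" | "qIm1 1 = 0" | "qIm2 1 = 0" | "qIm3 1 = 0"

primcorec times_quat where
  "qRe (x * y) = qRe x * qRe y - qIm1 x * qIm1 y - qIm2 x * qIm2 y - qIm3 x * qIm3 y"
| "qIm1 (x * y) = qRe x * qIm1 y + qIm1 x * qRe y + qIm2 x * qIm3 y - qIm3 x * qIm2 y"
| "qIm2 (x * y) = qRe x * qIm2 y - qIm1 x * qIm3 y + qIm2 x * qRe y + qIm3 x * qIm1 y"
| "qIm3 (x * y) = qRe x * qIm3 y + qIm1 x * qIm2 y - qIm2 x * qIm1 y + qIm3 x * qRe y"

instance
  by standard (simp_all add: quat_eq_iff algebra_simps)

end

instantiation quat :: real_algebra_1
begin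

primcorec scaleR_quat where
  "qRe (scaleR r x) = r * qRe x"
| "qIm1 (scaleR r x) = r * qIm1 x"
| "qIm2 (scaleR r x) = r * qIm2 x"
| "qIm3 (scaleR r x) = r * qIm3 x"

instance
  by standard (simp_all add: quat_eq_iff algebra_simps)

end

lemma of_real_quat_sel [simp]:
  "qRe (of_real r) = r" "qIm1 (of_real r) = 0" "qIm2 (of_real r) = 0" "qIm3 (of_real r) = 0"
  by (simp_all add: of_real_def)

instantiation quat :: real_inner
begin

definition inner_quat_def:
  "inner x y = qRe x * qRe y + qIm1 x * qIm1 y + qIm2 x * qIm2 y + qIm3 x * qIm3 y"

definition norm_quat_def:
  "norm (x :: quat) = sqrt ((qRe x)\<^sup>2 + (qIm1 x)\<^sup>2 + (qIm2 x)\<^sup>2 + (qIm3 x)\<^sup>2)"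

definition sgn_quat_def: "sgn (x :: quat) = x /\<^sub>R norm x"

definition dist_quat_def: "dist (x :: quat) y = norm (x - y)"

definition uniformity_quat_def [code del]:
  "(uniformity :: (quat \<times> quat) filter) = (INF e\<in>{0 <..}. principal {(x, y). dist x y < e})"

definition open_quat_def [code del]:
  "open (U :: quat set) \<longleftrightarrow> (\<forall>x\<in>U. eventually (\<lambda>(x', y). x' = x \<longrightarrow> y \<in> U) uniformity)"

instance
proof
  fix x y z :: quat and r :: real
  show "inner x y = inner y x"
    by (simp add: inner_quat_def mult.commute)
  show "inner (x + y) z = inner x z + inner y z"
    by (simp add: inner_quat_def algebra_simps)
  show "inner (scaleR r x) y = r * inner x y"
    by (simp add: inner_quat_def algebra_simps)
  show "0 \<le> inner x x"
    by (simp add: inner_quat_def)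
  show "inner x x = 0 \<longleftrightarrow> x = 0"
    by (simp add: inner_quat_def add_nonneg_eq_0_iff quat_eq_iff)
  show "norm x = sqrt (inner x x)"
    by (simp add: inner_quat_def norm_quat_def power2_eq_square)
qed (rule sgn_quat_def dist_quat_def open_quat_def uniformity_quat_def)+

end

instance quat :: real_normed_algebra_1
proof
  fix x y :: quat
  have "norm (x * y) = norm x * norm y"
    unfolding norm_quat_def real_sqrt_mult [symmetric] times_quat.sel
    by (rule arg_cong [where f = sqrt]) algebra
  then show "norm (x * y) \<le> norm x * norm y"
    by simp
  show "norm (1 :: quat) = 1"
    by (simp add: norm_quat_def)
qed

instantiation quat :: euclidean_space
begin

definition Basis_quat_def: "Basis = {Quat 1 0 0 0, Quat 0 1 0 0, Quat 0 0 1 0, Quat 0 0 0 1}"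

instance
proof
  fix x :: quat
  show "(\<forall>u\<in>Basis. inner x u = 0) \<longleftrightarrow> x = 0"
    unfolding quat_eq_iff [of x 0] by (simp add: Basis_quat_def inner_quat_def)
qed (auto simp: Basis_quat_def inner_quat_def)

end

section \<open>Slices and slice regular functions\<close>

definition imag_units :: "quat set" where
  "imag_units = {q. q\<^sup>2 = -1}"

definition slice_plane :: "quat \<Rightarrow> quat set" where
  "slice_plane I = {of_real x + of_real y * I | x y :: real. True}"

definition slice_open :: "quat set \<Rightarrow> bool" where
  "slice_open \<Omega> \<longleftrightarrow>
     (\<forall>I\<in>imag_units. openin (top_of_set (slice_plane I)) (\<Omega> \<inter> slice_plane I))"

text \<open>
  Functions on subsets of the quaternions are total functions of type \<open>quat \<Rightarrow> quat\<close> whose values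
  outside the set are irrelevant. The following notion is meant for \<open>U\<close> open in
  \<open>slice_plane I\<close>; the partial derivatives \<open>hx\<close>, \<open>hy\<close> at a point of \<open>U\<close> then only depend on
  \<open>h\<close> on \<open>U\<close>.
\<close>

definition left_slice_holomorphic_on :: "quat \<Rightarrow> quat set \<Rightarrow> (quat \<Rightarrow> quat) \<Rightarrow> bool" where
  "left_slice_holomorphic_on I U h \<longleftrightarrow>
     (\<exists>hx hy. continuous_on U hx \<and> continuous_on U hy \<and>
        (\<forall>x y. of_real x + of_real y * I \<in> U \<longrightarrow>
           ((\<lambda>s. h (of_real s + of_real y * I)) has_vector_derivative
              hx (of_real x + of_real y * I)) (at x) \<and>
           ((\<lambda>t. h (of_real x + of_real t * I)) has_vector_derivative
              hy (of_real x + of_real y * I)) (at y) \<and>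
           (1 / 2) *\<^sub>R (hx (of_real x + of_real y * I) + I * hy (of_real x + of_real y * I)) = 0))"

definition slice_regular_on :: "quat set \<Rightarrow> (quat \<Rightarrow> quat) \<Rightarrow> bool" where
  "slice_regular_on \<Omega> f \<longleftrightarrow>
     (\<forall>I\<in>imag_units. left_slice_holomorphic_on I (\<Omega> \<inter> slice_plane I) f)"

section \<open>Path-slice functions\<close>

definition real_start_paths :: "(real \<Rightarrow> complex) set" where
  "real_start_paths = {\<gamma>. path \<gamma> \<and> pathstart \<gamma> \<in> \<real>}"

definition slice_embed :: "quat \<Rightarrow> complex \<Rightarrow> quat" where
  "slice_embed I z = of_real (Re z) + of_real (Im z) * I"

text \<open>
  The column \<open>F t\<close> has type \<open>quat ^ 2\<close>; the product of the row \<open>(1, I)\<close> with it is written out.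
\<close>

definition path_slice_on :: "quat set \<Rightarrow> (quat \<Rightarrow> quat) \<Rightarrow> bool" where
  "path_slice_on \<Omega> f \<longleftrightarrow>
     (\<forall>\<gamma>\<in>real_start_paths. \<exists>F :: real \<Rightarrow> quat ^ 2.
        \<forall>I\<in>imag_units. path_image (slice_embed I \<circ> \<gamma>) \<subseteq> \<Omega> \<longrightarrow>
          (\<forall>t\<in>{0..1}. f ((slice_embed I \<circ> \<gamma>) t) = 1 * F t $ 1 + I * F t $ 2))"

end

(*
  For J \<noteq> K in imag_units put M = (J - K)^-1. On the slice of I the function
  z^I \<mapsto> (I - K) M f(z^J) + (J - I) M f(z^K) is left holomorphic wherever f(z^J) and
  f(z^K) are defined, because (I - K) M J = I (I - K) M and (J - I) M K = I (J - I) M. It agrees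
  with f on the real axis, as (I - K) M + (J - I) M = 1. By the identity principle it then agrees
  with f along any path that starts on the real axis and whose I-, J- and K-lifts stay in the
  domain, and the right-hand side is affine in I. Holomorphy and the identity principle are
  reduced to complex-valued functions by composing with the real-linear maps \<psi> from the
  quaternions to the complex numbers with \<psi>(I q) = i \<psi>(q), which separate points.
*)

theory Submission
  imports Defs "HOL-Complex_Analysis.Conformal_Mappings"
begin

section \<open>Quaternionic imaginary units\<close>

lemma imag_units_square: "I \<in> imag_units \<Longrightarrow> I * I = -1"
  by (simp add: imag_units_def power2_eq_square)

lemma imag_units_times_times:
  assumes "I \<in> imag_units"
  shows "I * (I * q) = - q"
  using imag_units_square[OF assms] by (simp flip: mult.assoc)

lemma imag_units_qRe:
  assumes "I \<in> imag_units"
  shows "qRe I = 0"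
proof (rule ccontr)
  assume "qRe I \<noteq> 0"
  moreover have "qIm1 I = 0 \<or> qRe I = 0" "qIm2 I = 0 \<or> qRe I = 0" "qIm3 I = 0 \<or> qRe I = 0"
    and re: "(qRe I)\<^sup>2 - (qIm1 I)\<^sup>2 - (qIm2 I)\<^sup>2 - (qIm3 I)\<^sup>2 = -1"
    using imag_units_square[OF assms] by (simp_all add: quat_eq_iff power2_eq_square)
  ultimately have "(qRe I)\<^sup>2 = -1"
    by simp
  then show False
    using zero_le_power2[of "qRe I"] by linarith
qed

text \<open>Imaginary units have real part 0, so \<open>J - K\<close> is purely imaginary and its
  square is minus its squared norm \<open>n\<close>. Dividing by \<open>- n\<close> gives the
  inverse.\<close>

lemma imag_units_diff_inverse:
  assumes "J \<in> imag_units" "K \<in> imag_units" "J \<noteq> K"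
  obtains M where "(J - K) * M = 1" "M * (J - K) = 1"
proof
  define n where "n = (norm (J - K))\<^sup>2"
  have "n \<noteq> 0"
    using assms by (simp add: n_def)
  have n: "n = (qIm1 (J - K))\<^sup>2 + (qIm2 (J - K))\<^sup>2 + (qIm3 (J - K))\<^sup>2"
    using assms by (simp add: n_def norm_quat_def imag_units_qRe)
  have sq: "(J - K) * (J - K) = - of_real n"
    unfolding n using assms by (simp add: quat_eq_iff imag_units_qRe power2_eq_square)
  show "(J - K) * ((- 1 / n) *\<^sub>R (J - K)) = 1" "((- 1 / n) *\<^sub>R (J - K)) * (J - K) = 1"
    using \<open>n \<noteq> 0\<close> by (simp_all add: sq of_real_def)
qed

text \<open>As \<open>J\<close> and \<open>K\<close> both square to -1,
  \<open>J * (J - K) = - ((J - K) * K)\<close>. Multiplying by \<open>M\<close> on both sides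
  cancels the differences.\<close>

lemma imag_units_inverse_diff_intertwine:
  assumes J: "J \<in> imag_units" and K: "K \<in> imag_units"
    and M: "(J - K) * M = 1" "M * (J - K) = 1"
  shows "M * J = - (K * M)"
proof -
  have "M * (J * (J - K)) * M = M * (- ((J - K) * K)) * M"
    using imag_units_square[OF J] imag_units_square[OF K] by (simp add: algebra_simps)
  moreover have "M * (J * (J - K)) * M = M * J * ((J - K) * M)"
    by (simp only: mult.assoc)
  moreover have "M * (- ((J - K) * K)) * M = - ((M * (J - K)) * K * M)"
    by (simp add: mult.assoc)
  ultimately show ?thesis
    using M by simp
qed

text \<open>Moving \<open>J\<close> leftwards past \<open>M\<close> turns it into
  \<open>- K\<close>, and \<open>(I - K) * K = - (I * (I - K))\<close>; the two signs
  cancel.\<close>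

lemma imag_units_interpolation_intertwine:
  assumes I: "I \<in> imag_units" and J: "J \<in> imag_units" and K: "K \<in> imag_units"
    and M: "(J - K) * M = 1" "M * (J - K) = 1"
  shows "(I - K) * M * J = I * ((I - K) * M)"
proof -
  have "(I - K) * M * J = - ((I - K) * K * M)"
    using imag_units_inverse_diff_intertwine[OF J K M] by (simp add: mult.assoc)
  also have "(I - K) * K = - (I * (I - K))"
    using imag_units_square[OF I] imag_units_square[OF K] by (simp add: algebra_simps)
  finally show ?thesis
    by (simp add: mult.assoc)
qed

section \<open>Complex-valued functionals compatible with an imaginary unit\<close>

text \<open>For an imaginary unit \<open>I\<close>, left multiplication by \<open>I\<close> is a
  complex structure on the quaternions. This is the unique complex-linear functional for it with
  real part \<open>inner q w\<close>.\<close>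

definition slice_functional :: "quat \<Rightarrow> quat \<Rightarrow> quat \<Rightarrow> complex" where
  "slice_functional I w q = Complex (inner q w) (- inner (I * q) w)"

lemma bounded_linear_slice_functional: "bounded_linear (slice_functional I w)"
proof -
  have "slice_functional I w = (\<lambda>q. inner q w *\<^sub>R 1 + inner (I * q) w *\<^sub>R (- \<i>))"
    by (auto simp: slice_functional_def complex_eq_iff)
  then show ?thesis
    by (auto intro!: bounded_linear_intros)
qed

lemma slice_functional_mult:
  "I \<in> imag_units \<Longrightarrow> slice_functional I w (I * q) = \<i> * slice_functional I w q"
  by (simp add: slice_functional_def complex_eq_iff imag_units_times_times)

lemma slice_functional_separates:
  assumes "\<And>w. slice_functional I w p = slice_functional I w q"
  shows "p = q"
proof -
  have "inner p w = inner q w" for w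
    using assms[of w] by (simp add: slice_functional_def)
  then show ?thesis
    by (metis inner_commute vector_eq_ldot)
qed

section \<open>Holomorphy on slices\<close>

text \<open>The x-partial together with a continuous y-partial yields real differentiability in two
  variables; the Cauchy-Riemann equation then makes the differential a complex
  multiplication.\<close>

lemma holomorphic_on_partialsI:
  fixes g :: "complex \<Rightarrow> complex"
  assumes "open S" and cont: "continuous_on S gy"
    and gx: "\<And>x y. Complex x y \<in> S \<Longrightarrow>
        ((\<lambda>s. g (Complex s y)) has_vector_derivative gx (Complex x y)) (at x)"
    and gy: "\<And>x y. Complex x y \<in> S \<Longrightarrow>
        ((\<lambda>t. g (Complex x t)) has_vector_derivative gy (Complex x y)) (at y)"
    and CR: "\<And>z. z \<in> S \<Longrightarrow> gy z = \<i> * gx z"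
  shows "g holomorphic_on S"
  unfolding holomorphic_on_open[OF \<open>open S\<close>]
proof
  fix z assume z: "z \<in> S"
  let ?S' = "(\<lambda>p. Complex (fst p) (snd p)) -` S"
  have contC: "continuous_on A (\<lambda>p. Complex (fst p) (snd p))" for A
    by (intro continuous_intros)
  have "open ?S'"
    using \<open>open S\<close> contC by (rule open_vimage)
  moreover have "(Re z, Im z) \<in> ?S'"
    using z by simp
  ultimately obtain A B where AB: "open A" "open B" "Re z \<in> A" "Im z \<in> B" "A \<times> B \<subseteq> ?S'"
    by (rule open_prod_elim) auto
  \<comment> \<open>The mean value argument in the y-direction needs a convex range of y, hence the
    ball inside \<open>B\<close>.\<close>
  obtain e where e: "e > 0" "ball (Im z) e \<subseteq> B"
    using AB openE by blast
  define Y where "Y = ball (Im z) e"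
  have Y: "open Y" "convex Y" "Im z \<in> Y"
    using e by (auto simp: Y_def)
  have sub: "Complex x y \<in> S" if "x \<in> A" "y \<in> Y" for x y
  proof -
    have "(x, y) \<in> A \<times> B"
      using e that by (auto simp: Y_def)
    then show ?thesis
      using AB by auto
  qed
  have "((\<lambda>(x, y). g (Complex x y)) has_derivative
      (\<lambda>(tx, ty). tx *\<^sub>R gx z + blinfun_apply (blinfun_scaleR_left (gy (Complex (Re z) (Im z)))) ty))
      (at (Re z, Im z) within A \<times> Y)"
  proof (rule has_derivative_partialsI)
    show "((\<lambda>x. g (Complex x (Im z))) has_derivative (\<lambda>tx. tx *\<^sub>R gx z)) (at (Re z) within A)"
      using gx[of "Re z" "Im z"] z
      by (auto simp: has_vector_derivative_def intro: has_derivative_at_withinI)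
    show "((\<lambda>y. g (Complex x y)) has_derivative
        blinfun_apply (blinfun_scaleR_left (gy (Complex x y)))) (at y within Y)"
      if "x \<in> A" "y \<in> Y" for x y
      using gy[OF sub[OF that]]
      by (auto simp: has_vector_derivative_def intro: has_derivative_at_withinI)
    have "continuous_on (A \<times> Y) (\<lambda>p. blinfun_scaleR_left (gy (Complex (fst p) (snd p))))"
      using sub by (intro continuous_intros continuous_on_compose2[OF cont contC]) auto
    then show "continuous (at (Re z, Im z) within A \<times> Y)
        (\<lambda>(x, y). blinfun_scaleR_left (gy (Complex x y)))"
      using AB Y by (auto simp: continuous_on_eq_continuous_within case_prod_unfold)
  qed (use Y in auto)
  then have der: "((\<lambda>(x, y). g (Complex x y)) has_derivative
      (\<lambda>(tx, ty). tx *\<^sub>R gx z + ty *\<^sub>R gy z)) (at (Re z, Im z))"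
    using AB Y by (simp add: at_within_open[of _ "A \<times> Y"] open_Times)
  have "((\<lambda>w. (Re w, Im w)) has_derivative (\<lambda>w. (Re w, Im w))) (at z)"
    by (intro derivative_eq_intros) auto
  from has_derivative_compose[OF this der]
  have "(g has_derivative (\<lambda>w. Re w *\<^sub>R gx z + Im w *\<^sub>R gy z)) (at z)"
    by simp
  moreover have "(\<lambda>w. Re w *\<^sub>R gx z + Im w *\<^sub>R gy z) = (*) (gx z)"
    using CR[OF z] by (auto simp: complex_eq_iff algebra_simps)
  ultimately show "\<exists>d. (g has_field_derivative d) (at z)"
    by (auto simp: has_field_derivative_def)
qed

lemma continuous_on_slice_embed: "continuous_on A (slice_embed I)"
  unfolding slice_embed_def by (intro continuous_intros)

lemma slice_embed_in_plane: "slice_embed I z \<in> slice_plane I"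
  by (auto simp: slice_embed_def slice_plane_def)

lemma open_slice_embed_vimage:
  assumes "slice_open \<Omega>" "I \<in> imag_units"
  shows "open (slice_embed I -` \<Omega>)"
proof -
  obtain T where "open T" "\<Omega> \<inter> slice_plane I = slice_plane I \<inter> T"
    using assms by (auto simp: slice_open_def openin_open)
  then have "slice_embed I -` \<Omega> = slice_embed I -` T"
    using slice_embed_in_plane by blast
  then show ?thesis
    using \<open>open T\<close> continuous_on_slice_embed by (simp add: open_vimage)
qed

text \<open>Applying \<psi> to \<open>hx = - (I * hy)\<close> gives the Cauchy-Riemann equation for
  complex-valued functions. Keeping \<psi> general allows functionals of the form
  \<open>q \<mapsto> \<psi> (c * q)\<close>.\<close>

lemma slice_regular_holomorphic:
  assumes "slice_open \<Omega>" and f: "slice_regular_on \<Omega> f" and I: "I \<in> imag_units"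
    and \<psi>: "bounded_linear \<psi>" "\<And>q. \<psi> (I * q) = \<i> * \<psi> q"
  shows "(\<lambda>z. \<psi> (f (slice_embed I z))) holomorphic_on slice_embed I -` \<Omega>"
proof -
  obtain hx hy where hy: "continuous_on (\<Omega> \<inter> slice_plane I) hy"
    and h: "\<And>x y. of_real x + of_real y * I \<in> \<Omega> \<inter> slice_plane I \<Longrightarrow>
           ((\<lambda>s. f (of_real s + of_real y * I)) has_vector_derivative
              hx (of_real x + of_real y * I)) (at x) \<and>
           ((\<lambda>t. f (of_real x + of_real t * I)) has_vector_derivative
              hy (of_real x + of_real y * I)) (at y) \<and>
           (1 / 2) *\<^sub>R (hx (of_real x + of_real y * I) + I * hy (of_real x + of_real y * I)) = 0"
    using f I unfolding slice_regular_on_def left_slice_holomorphic_on_def by blast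
  have h': "((\<lambda>s. f (slice_embed I (Complex s y))) has_vector_derivative
              hx (slice_embed I (Complex x y))) (at x)"
           "((\<lambda>t. f (slice_embed I (Complex x t))) has_vector_derivative
              hy (slice_embed I (Complex x y))) (at y)"
           "hx (slice_embed I (Complex x y)) = - (I * hy (slice_embed I (Complex x y)))"
    if "slice_embed I (Complex x y) \<in> \<Omega>" for x y
    using h[of x y] that slice_embed_in_plane[of I "Complex x y"]
    by (simp_all add: slice_embed_def eq_neg_iff_add_eq_0)
  interpret \<psi>: bounded_linear \<psi> by fact
  show ?thesis
  proof (rule holomorphic_on_partialsI)
    show "open (slice_embed I -` \<Omega>)"
      using assms by (intro open_slice_embed_vimage)
    show "continuous_on (slice_embed I -` \<Omega>) (\<lambda>z. \<psi> (hy (slice_embed I z)))"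
      using slice_embed_in_plane
      by (intro \<psi>.continuous_on continuous_on_compose2[OF hy continuous_on_slice_embed]) auto
    show "\<psi> (hy (slice_embed I z)) = \<i> * \<psi> (hx (slice_embed I z))"
      if "z \<in> slice_embed I -` \<Omega>" for z
      using h'(3)[of "Re z" "Im z"] that by (simp add: \<psi>.neg \<psi>(2))
  qed (auto intro: \<psi>.has_vector_derivative h')
qed

section \<open>The representation formula along a path\<close>

lemma slice_embed_Reals: "z \<in> \<real> \<Longrightarrow> slice_embed I z = of_real (Re z)"
  by (auto simp: slice_embed_def complex_is_Real_iff)

lemma slice_regular_representation:
  assumes \<Omega>: "slice_open \<Omega>" and f: "slice_regular_on \<Omega> f"
    and I: "I \<in> imag_units" and J: "J \<in> imag_units" and K: "K \<in> imag_units"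
    and M: "(J - K) * M = 1" "M * (J - K) = 1"
    and S: "connected S" "S \<inter> \<real> \<noteq> {}"
    and sub: "slice_embed I ` S \<subseteq> \<Omega>" "slice_embed J ` S \<subseteq> \<Omega>" "slice_embed K ` S \<subseteq> \<Omega>"
    and z: "z \<in> S"
  shows "f (slice_embed I z) =
    (I - K) * M * f (slice_embed J z) + (J - I) * M * f (slice_embed K z)"
proof (rule slice_functional_separates)
  fix w
  define \<psi> where "\<psi> = slice_functional I w"
  interpret \<psi>: bounded_linear \<psi>
    unfolding \<psi>_def by (rule bounded_linear_slice_functional)
  have \<psi>_mult: "\<psi> (I * q) = \<i> * \<psi> q" for q
    unfolding \<psi>_def using I by (rule slice_functional_mult)
  define D where "D L = slice_embed L -` \<Omega>" for L
  define V where "V = D I \<inter> D J \<inter> D K"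
  have "open V"
    unfolding V_def D_def using \<Omega> I J K by (intro open_Int open_slice_embed_vimage)
  have "S \<subseteq> V"
    using sub by (auto simp: V_def D_def)
  obtain r where r: "r \<in> S" "r \<in> \<real>"
    using S by blast
  \<comment> \<open>The identity principle needs an open connected set, whereas \<open>S\<close> is
    only connected; so \<open>S\<close> is enlarged to a component of the common domain
    \<open>V\<close>.\<close>
  define C where "C = connected_component_set V r"
  have C: "open C" "connected C" "C \<subseteq> V"
    unfolding C_def using \<open>open V\<close> by (simp_all add: open_connected_component connected_component_subset)
  have "S \<subseteq> C"
    unfolding C_def using r S \<open>S \<subseteq> V\<close> by (intro connected_component_maximal)
  define h where "h z = \<psi> (f (slice_embed I z)) -
    (\<psi> ((I - K) * M * f (slice_embed J z)) + \<psi> ((J - I) * M * f (slice_embed K z)))" for z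
  have J': "(I - K) * M * J = I * ((I - K) * M)"
    using I J K M by (rule imag_units_interpolation_intertwine)
  \<comment> \<open>The same intertwining with \<open>J\<close> and \<open>K\<close> exchanged, as
    \<open>- M\<close> is the inverse of \<open>K - J\<close>.\<close>
  have "(I - J) * (- M) * K = I * ((I - J) * (- M))"
    using I K J by (rule imag_units_interpolation_intertwine) (use M in \<open>simp_all add: algebra_simps\<close>)
  then have K': "(J - I) * M * K = I * ((J - I) * M)"
    by (simp add: algebra_simps)
  \<comment> \<open>Composed with its coefficient, \<psi> turns left multiplication by
    \<open>J\<close>, respectively \<open>K\<close>, into multiplication by \<open>\<i>\<close>, so
    both terms are holomorphic by the slice condition for their own unit.\<close>
  have "\<psi> ((I - K) * M * (J * q)) = \<i> * \<psi> ((I - K) * M * q)"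
    and "\<psi> ((J - I) * M * (K * q)) = \<i> * \<psi> ((J - I) * M * q)" for q
    using \<psi>_mult J' K' by (metis mult.assoc)+
  then have "(\<lambda>z. \<psi> (f (slice_embed I z))) holomorphic_on D I"
    "(\<lambda>z. \<psi> ((I - K) * M * f (slice_embed J z))) holomorphic_on D J"
    "(\<lambda>z. \<psi> ((J - I) * M * f (slice_embed K z))) holomorphic_on D K"
    unfolding D_def using \<psi>_mult
    by (intro slice_regular_holomorphic[OF \<Omega> f] I J K;
        auto intro: \<psi>.bounded_linear_axioms bounded_linear_compose bounded_linear_mult_right)+
  then have "h holomorphic_on C"
    unfolding h_def using C by (intro holomorphic_intros) (auto simp: V_def elim: holomorphic_on_subset)
  moreover have "r islimpt C \<inter> \<real>"
    unfolding islimpt_approachable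
  proof (intro allI impI)
    fix e :: real assume "e > 0"
    obtain d where d: "d > 0" "ball r d \<subseteq> C"
      using C r \<open>S \<subseteq> C\<close> openE by blast
    \<comment> \<open>A real shift of \<open>r\<close>, nonzero and shorter than both
      \<open>d\<close> and \<open>e\<close>.\<close>
    have "r + of_real (min d e / 2) \<in> C"
      using d \<open>e > 0\<close> by (intro subsetD[OF d(2)]) (simp add: dist_norm)
    then show "\<exists>x\<in>C \<inter> \<real>. x \<noteq> r \<and> dist x r < e"
      using d \<open>e > 0\<close> r by (intro bexI[of _ "r + of_real (min d e / 2)"]) (auto simp: dist_norm)
  qed
  moreover have "h x = 0" if "x \<in> C \<inter> \<real>" for x
  proof -
    \<comment> \<open>The coefficients add up to \<open>(J - K) * M\<close>, and at a real point all
      three embeddings coincide.\<close>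
    have "(I - K) * M + (J - I) * M = 1"
      using M by (simp flip: distrib_right)
    then have "(I - K) * M * q + (J - I) * M * q = q" for q
      by (simp flip: distrib_right)
    then show ?thesis
      using that by (simp add: h_def slice_embed_Reals flip: \<psi>.add)
  qed
  ultimately have "h z = 0"
    using C r z \<open>S \<subseteq> C\<close> by (intro analytic_continuation[of h C "C \<inter> \<real>" r z]) auto
  then show "slice_functional I w (f (slice_embed I z)) = slice_functional I w
      ((I - K) * M * f (slice_embed J z) + (J - I) * M * f (slice_embed K z))"
    by (simp add: h_def \<psi>.add flip: \<psi>_def)
qed

theorem theorem7p4:
  fixes \<Omega> :: "quat set" and f :: "quat \<Rightarrow> quat"
  assumes "slice_open \<Omega>"
    and "slice_regular_on \<Omega> f"
  shows "path_slice_on \<Omega> f"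
  unfolding path_slice_on_def
proof
  fix \<gamma> assume \<gamma>: "\<gamma> \<in> real_start_paths"
  define G where "G = {I \<in> imag_units. path_image (slice_embed I \<circ> \<gamma>) \<subseteq> \<Omega>}"
  have "\<exists>a b. \<forall>I\<in>G. \<forall>t\<in>{0..1}. f (slice_embed I (\<gamma> t)) = a t + I * b t"
  proof (cases "\<exists>J\<in>G. \<exists>K\<in>G. J \<noteq> K")
    \<comment> \<open>With at most one admissible unit, the values of \<open>f\<close> along its
      lift serve as \<open>a\<close>, and \<open>b\<close> is 0.\<close>
    case False
    then obtain J where "G \<subseteq> {J}"
      by blast
    then have "\<forall>I\<in>G. \<forall>t\<in>{0..1}. f (slice_embed I (\<gamma> t)) = f (slice_embed J (\<gamma> t)) + I * 0"
      by auto
    then show ?thesis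
      by (intro exI)
  next
    case True
    then obtain J K where JK: "J \<in> G" "K \<in> G" "J \<noteq> K"
      by blast
    then obtain M where M: "(J - K) * M = 1" "M * (J - K) = 1"
      using imag_units_diff_inverse[of J K] by (auto simp: G_def)
    define u v where "u t = f (slice_embed J (\<gamma> t))" and "v t = f (slice_embed K (\<gamma> t))" for t
    have conn: "connected (path_image \<gamma>)"
      using \<gamma> by (simp add: real_start_paths_def connected_path_image)
    have real: "path_image \<gamma> \<inter> \<real> \<noteq> {}"
      using \<gamma> pathstart_in_path_image[of \<gamma>] by (auto simp: real_start_paths_def)
    \<comment> \<open>The representation formula sorted by powers of \<open>I\<close>:
      \<open>J\<close>, \<open>K\<close> and \<open>M\<close> are fixed, so neither coefficient
      depends on \<open>I\<close>.\<close>
    have "f (slice_embed I (\<gamma> t)) = (J * M * v t - K * M * u t) + I * (M * (u t - v t))"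
      if "I \<in> G" "t \<in> {0..1}" for I t
    proof -
      have "f (slice_embed I (\<gamma> t)) = (I - K) * M * u t + (J - I) * M * v t"
        unfolding u_def v_def
        by (rule slice_regular_representation[OF assms _ _ _ M conn real])
          (use that JK in \<open>auto simp: G_def path_image_def\<close>)
      then show ?thesis
        by (simp add: algebra_simps)
    qed
    then show ?thesis
      by (intro exI[of _ "\<lambda>t. J * M * v t - K * M * u t"] exI[of _ "\<lambda>t. M * (u t - v t)"]) blast
  qed
  then obtain a b where ab: "\<And>I t. I \<in> G \<Longrightarrow> t \<in> {0..1} \<Longrightarrow> f (slice_embed I (\<gamma> t)) = a t + I * b t"
    by blast
  show "\<exists>F :: real \<Rightarrow> quat ^ 2. \<forall>I\<in>imag_units. path_image (slice_embed I \<circ> \<gamma>) \<subseteq> \<Omega> \<longrightarrow>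
      (\<forall>t\<in>{0..1}. f ((slice_embed I \<circ> \<gamma>) t) = 1 * F t $ 1 + I * F t $ 2)"
    by (rule exI[of _ "\<lambda>t. vector [a t, b t]"]) (use ab in \<open>auto simp: G_def\<close>)
qed

end
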